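(* Let $\Sigma_f$ be a rotational Ricci surface in $\mathbb{R}^3$, where $f:I\to\mathbb{R}$ is a positive smooth function on an open interval $I\subseteq\mathbb{R}$ defined implicitly by $$af(s)-c\log\left(af(s)+c\right)=a^2s+d$$ for some $a,c,d\in\mathbb{R}$ with $a\neq0$ and $c\neq 0$ such that $af(s)+c>0$ for each $s\in I$. Suppose that the Gaussian curvature $K$ of $\Sigma_f$ does not vanish and set $$s_0=\frac{c}{a(1-a)}-\frac{c}{a^2}\log\left(\frac{c}{1-a}\right)-\frac{d}{a^2}$$ when $(1-a)c>0$. Then $f$ is a strictly increasing diffeomorphism on $I$ (onto its image), and one of the following holds. 1. If $K<0$, then $a\in(0,+\infty)$, $c\in(-\infty,0)$, $f$ is asymptotic to $-\frac ca$, and - either $I\subseteq\mathbb{R}$ and $f(I)\subseteq\left(-\frac ca,+\infty\right)$ for $0<a\le1$; - or $I\subseteq(-\infty,s_0)$ and $f(I)\subseteq\left(-\frac ca,\frac{c}{1-a}\right)$ for $a>1$. 2. If $K>0$, then $a\in(-\infty,0)\cup(0,1)$, $c\in(0,+\infty)$ and - either $I\subseteq(s_0,+\infty)$ and $f(I)\subseteq\left(\frac{c}{1-a},-\frac ca\right)$ for $a<0$; - or $I\subseteq(s_0,+\infty)$ and $f(I)\subseteq\left(\frac{c}{1-a},+\infty\right)$ for $0<a<1$.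
   Context: Rotational surfaces: let $I\subseteq\mathbb{R}$ be an open interval, and let $f,g:I\to\mathbb{R}$ be smooth with $f>0$, $(f')^2+(g')^2=1$ and $g'\ge 0$. The rotational surface $\Sigma_f\subset\mathbb{R}^3$ is the surface parametrised by $X(s,\theta)=(f(s)\cos\theta,f(s)\sin\theta,g(s))$; its profile curve is $\alpha(s)=(f(s),0,g(s))$, parametrised by arc length. In particular $|f'|\le 1$, and, up to a vertical isometry of $\mathbb{R}^3$, $g(s)=\int_{\sigma}^s\sqrt{1-f'(\zeta)^2}\,d\zeta$ with $\sigma\in I$, so $\Sigma_f$ is determined by $f$. The induced metric is $ds^2+f(s)^2d\theta^2$ and the Gaussian curvature is $K=-f''/f$. A rotational Ricci surface is a rotational surface $\Sigma_f$ whose Gaussian curvature satisfies the Ricci condition $K\Delta K-\|\nabla K\|^2-4K^3=0$, equivalently $KK''-(K')^2-4K^3+\frac{f'}{f}KK'=0$ with $K=-f''/f$. "$f$ is asymptotic to $-\frac ca$" means that, when $f$ is taken on its maximal interval of definition (which is then unbounded below), $f(s)\to-\frac ca$ as $s\to-\infty$. *)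

theory Defs
  imports "HOL-Analysis.Analysis"
begin

section \<open>Smooth functions and diffeomorphisms between open subsets of the line\<close>

text \<open>Only used for open sets \<open>S\<close>, where the iterated derivatives at points of \<open>S\<close> depend
  only on the restriction of the function to \<open>S\<close>.\<close>

definition smooth_on :: "real set \<Rightarrow> (real \<Rightarrow> real) \<Rightarrow> bool" where
  "smooth_on S f \<longleftrightarrow> (\<forall>n. \<forall>x\<in>S. (deriv ^^ n) f field_differentiable (at x))"

definition diffeomorphism_on :: "real set \<Rightarrow> real set \<Rightarrow> (real \<Rightarrow> real) \<Rightarrow> bool" where
  "diffeomorphism_on S T f \<longleftrightarrow>
     open S \<and> open T \<and> bij_betw f S T \<and> smooth_on S f \<and> smooth_on T (the_inv_into S f)"

definition open_interval :: "real set \<Rightarrow> bool" where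
  "open_interval I \<longleftrightarrow> open I \<and> is_interval I \<and> I \<noteq> {}"


section \<open>Parametrised surfaces\<close>

definition partial1 :: "(real \<Rightarrow> real \<Rightarrow> 'a::real_normed_vector) \<Rightarrow> real \<Rightarrow> real \<Rightarrow> 'a" where
  "partial1 X u v = vector_derivative (\<lambda>t. X t v) (at u)"

definition partial2 :: "(real \<Rightarrow> real \<Rightarrow> 'a::real_normed_vector) \<Rightarrow> real \<Rightarrow> real \<Rightarrow> 'a" where
  "partial2 X u v = vector_derivative (\<lambda>t. X u t) (at v)"

definition metric_E :: "(real \<Rightarrow> real \<Rightarrow> real^3) \<Rightarrow> real \<Rightarrow> real \<Rightarrow> real" where
  "metric_E X u v = partial1 X u v \<bullet> partial1 X u v"

definition metric_F :: "(real \<Rightarrow> real \<Rightarrow> real^3) \<Rightarrow> real \<Rightarrow> real \<Rightarrow> real" where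
  "metric_F X u v = partial1 X u v \<bullet> partial2 X u v"

definition metric_G :: "(real \<Rightarrow> real \<Rightarrow> real^3) \<Rightarrow> real \<Rightarrow> real \<Rightarrow> real" where
  "metric_G X u v = partial2 X u v \<bullet> partial2 X u v"

definition metric_det :: "(real \<Rightarrow> real \<Rightarrow> real^3) \<Rightarrow> real \<Rightarrow> real \<Rightarrow> real" where
  "metric_det X u v = metric_E X u v * metric_G X u v - (metric_F X u v)\<^sup>2"

definition surface_normal :: "(real \<Rightarrow> real \<Rightarrow> real^3) \<Rightarrow> real \<Rightarrow> real \<Rightarrow> real^3" where
  "surface_normal X u v = sgn (cross3 (partial1 X u v) (partial2 X u v))"

definition gaussian_curvature :: "(real \<Rightarrow> real \<Rightarrow> real^3) \<Rightarrow> real \<Rightarrow> real \<Rightarrow> real" where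
  "gaussian_curvature X u v =
     ((partial1 (partial1 X) u v \<bullet> surface_normal X u v) *
      (partial2 (partial2 X) u v \<bullet> surface_normal X u v)
      - (partial2 (partial1 X) u v \<bullet> surface_normal X u v)\<^sup>2) / metric_det X u v"

text \<open>Squared norm of the gradient and Laplace--Beltrami operator (with the sign convention
  \<open>\<Delta> = div grad\<close>) of a function on the surface, in the coordinates given by \<open>X\<close>.\<close>

definition grad_norm_sq ::
  "(real \<Rightarrow> real \<Rightarrow> real^3) \<Rightarrow> (real \<Rightarrow> real \<Rightarrow> real) \<Rightarrow> real \<Rightarrow> real \<Rightarrow> real" where
  "grad_norm_sq X \<phi> u v =
     (metric_G X u v * (partial1 \<phi> u v)\<^sup>2
      - 2 * metric_F X u v * partial1 \<phi> u v * partial2 \<phi> u v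
      + metric_E X u v * (partial2 \<phi> u v)\<^sup>2) / metric_det X u v"

definition laplace_beltrami ::
  "(real \<Rightarrow> real \<Rightarrow> real^3) \<Rightarrow> (real \<Rightarrow> real \<Rightarrow> real) \<Rightarrow> real \<Rightarrow> real \<Rightarrow> real" where
  "laplace_beltrami X \<phi> u v =
     (partial1 (\<lambda>u v. (metric_G X u v * partial1 \<phi> u v - metric_F X u v * partial2 \<phi> u v)
                        / sqrt (metric_det X u v)) u v
      + partial2 (\<lambda>u v. (metric_E X u v * partial2 \<phi> u v - metric_F X u v * partial1 \<phi> u v)
                        / sqrt (metric_det X u v)) u v) / sqrt (metric_det X u v)"

definition ricci_condition_at :: "(real \<Rightarrow> real \<Rightarrow> real^3) \<Rightarrow> real \<Rightarrow> real \<Rightarrow> bool" where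
  "ricci_condition_at X u v \<longleftrightarrow>
     (let K = gaussian_curvature X in
      K u v * laplace_beltrami X K u v - grad_norm_sq X K u v - 4 * (K u v) ^ 3 = 0)"


section \<open>Rotational Ricci surfaces\<close>

definition rot_param :: "(real \<Rightarrow> real) \<Rightarrow> (real \<Rightarrow> real) \<Rightarrow> real \<Rightarrow> real \<Rightarrow> real^3" where
  "rot_param f g s \<theta> = vector [f s * cos \<theta>, f s * sin \<theta>, g s]"

definition rotational_profile :: "real set \<Rightarrow> (real \<Rightarrow> real) \<Rightarrow> (real \<Rightarrow> real) \<Rightarrow> bool" where
  "rotational_profile I f g \<longleftrightarrow>
     open_interval I \<and> smooth_on I f \<and> smooth_on I g \<and>
     (\<forall>s\<in>I. f s > 0 \<and> (deriv f s)\<^sup>2 + (deriv g s)\<^sup>2 = 1 \<and> deriv g s \<ge> 0)"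

definition rotational_ricci :: "real set \<Rightarrow> (real \<Rightarrow> real) \<Rightarrow> (real \<Rightarrow> real) \<Rightarrow> bool" where
  "rotational_ricci I f g \<longleftrightarrow>
     rotational_profile I f g \<and> (\<forall>s\<in>I. \<forall>\<theta>. ricci_condition_at (rot_param f g) s \<theta>)"

definition implicitly_defined ::
  "real \<Rightarrow> real \<Rightarrow> real \<Rightarrow> real set \<Rightarrow> (real \<Rightarrow> real) \<Rightarrow> bool" where
  "implicitly_defined a c d I f \<longleftrightarrow>
     (\<forall>s\<in>I. a * f s + c > 0 \<and> a * f s - c * ln (a * f s + c) = a\<^sup>2 * s + d)"


section \<open>Asymptotics on the maximal interval of definition\<close>

definition extends_to ::
  "real set \<Rightarrow> (real \<Rightarrow> real) \<Rightarrow> real set \<Rightarrow> (real \<Rightarrow> real) \<Rightarrow> bool" where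
  "extends_to I f J h \<longleftrightarrow> I \<subseteq> J \<and> (\<forall>s\<in>I. h s = f s)"

definition admissible ::
  "real \<Rightarrow> real \<Rightarrow> real \<Rightarrow> real set \<Rightarrow> (real \<Rightarrow> real) \<Rightarrow> bool" where
  "admissible a c d I f \<longleftrightarrow> (\<exists>g. rotational_ricci I f g) \<and> implicitly_defined a c d I f"

text \<open>The maximal interval of definition is taken to be that of the greatest extension of \<open>f\<close>
  as the profile function of a rotational Ricci surface satisfying the same implicit equation.
  Such an extension is unique up to the irrelevant values of \<open>h\<close> outside \<open>J\<close>.\<close>

definition maximal_extension ::
  "real \<Rightarrow> real \<Rightarrow> real \<Rightarrow> real set \<Rightarrow> (real \<Rightarrow> real) \<Rightarrow> real set \<Rightarrow> (real \<Rightarrow> real) \<Rightarrow> bool" where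
  "maximal_extension a c d I f J h \<longleftrightarrow>
     admissible a c d J h \<and> extends_to I f J h \<and>
     (\<forall>J' h'. admissible a c d J' h' \<and> extends_to I f J' h' \<longrightarrow> extends_to J' h' J h)"

definition asymptotic_to ::
  "real \<Rightarrow> real \<Rightarrow> real \<Rightarrow> real set \<Rightarrow> (real \<Rightarrow> real) \<Rightarrow> real \<Rightarrow> bool" where
  "asymptotic_to a c d I f L \<longleftrightarrow>
     (\<exists>J h. maximal_extension a c d I f J h \<and> \<not> bdd_below J \<and> (h \<longlongrightarrow> L) at_bot)"

end

theory Submission
  imports Defs
begin

text \<open>Differentiating the implicit equation gives the autonomous equation \<open>f' = a + c / f\<close>,
  whence \<open>K = - f'' / f = c (a f + c) / f^4\<close> has the sign of \<open>c\<close>. Unit speed and \<open>c \<noteq> 0\<close> force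
  \<open>0 < f' < 1\<close>, which confines \<open>f\<close> to an interval \<open>D\<close> with end points among \<open>- c / a\<close>,
  \<open>c / (1 - a)\<close> and infinity. On \<open>D\<close> the implicit equation expresses \<open>s\<close> as a strictly increasing
  function of \<open>f\<close>, whose value at \<open>c / (1 - a)\<close> is \<open>s\<^sub>0\<close>. Conversely every solution of the
  equation \<open>f' = a + c / f\<close> with slope below 1 yields a Ricci surface, so the inverse of that function
  on all of \<open>D\<close> is the greatest extension of \<open>f\<close>; for \<open>c < 0\<close> its domain reaches \<open>-\<infinity>\<close>
  because the logarithm blows up as \<open>f\<close> tends to \<open>- c / a\<close>.\<close>

subsection \<open>Smooth functions on open sets\<close>

text \<open>Finite-order form of \<open>smooth_on\<close>, so that smoothness can be proved by
  induction on the order. Only derivatives of order below \<open>n\<close> are required to be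
  differentiable, hence order 0 is vacuous and the inductions start for free.\<close>

definition differentiable_upto :: "nat \<Rightarrow> real set \<Rightarrow> (real \<Rightarrow> real) \<Rightarrow> bool" where
  "differentiable_upto n S f \<longleftrightarrow> (\<forall>m<n. \<forall>x\<in>S. (deriv ^^ m) f field_differentiable (at x))"

lemma smooth_on_iff_differentiable_upto: "smooth_on S f \<longleftrightarrow> (\<forall>n. differentiable_upto n S f)"
  unfolding smooth_on_def differentiable_upto_def by blast

lemma differentiable_upto_0 [simp]: "differentiable_upto 0 S f"
  by (simp add: differentiable_upto_def)

lemma differentiable_upto_Suc:
  "differentiable_upto (Suc n) S f \<longleftrightarrow>
     (\<forall>x\<in>S. f field_differentiable (at x)) \<and> differentiable_upto n S (deriv f)"
  unfolding differentiable_upto_def All_less_Suc2 by (simp add: funpow_swap1)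

lemma differentiable_upto_SucD: "differentiable_upto (Suc n) S f \<Longrightarrow> differentiable_upto n S f"
  by (simp add: differentiable_upto_def)

text \<open>Agreement on an open set is agreement near each of its points, and this passes to all
  iterated derivatives.\<close>

lemma differentiable_upto_cong:
  assumes "open S" "\<And>x. x \<in> S \<Longrightarrow> f x = g x" "differentiable_upto n S f"
  shows "differentiable_upto n S g"
  unfolding differentiable_upto_def
proof (intro allI impI ballI)
  fix m x assume "m < n" "x \<in> S"
  have "\<forall>\<^sub>F y in nhds x. (deriv ^^ m) f y = (deriv ^^ m) g y"
    using eventually_nhds_in_open[OF assms(1) \<open>x \<in> S\<close>]
  proof eventually_elim
    case (elim y)
    show ?case
      by (rule higher_deriv_cong_ev[OF _ refl])
         (use eventually_nhds_in_open[OF assms(1) elim] assms(2) in \<open>auto elim: eventually_mono\<close>)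
  qed
  then show "(deriv ^^ m) g field_differentiable at x"
    using assms(3) \<open>m < n\<close> \<open>x \<in> S\<close> DERIV_cong_ev[OF refl _ refl]
    unfolding differentiable_upto_def field_differentiable_def by blast
qed

lemma smooth_on_cong:
  assumes "open S" "\<And>x. x \<in> S \<Longrightarrow> f x = g x" "smooth_on S f"
  shows "smooth_on S g"
  using assms(3) differentiable_upto_cong[OF assms(1,2)]
  by (simp add: smooth_on_iff_differentiable_upto)

text \<open>Lets an explicit formula, valid only on \<open>S\<close>, stand in for
  \<open>deriv f\<close>.\<close>

lemma differentiable_upto_SucI:
  assumes "open S" "\<And>x. x \<in> S \<Longrightarrow> (f has_real_derivative f' x) (at x)"
    and "differentiable_upto n S f'"
  shows "differentiable_upto (Suc n) S f"
  unfolding differentiable_upto_Suc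
proof
  show "\<forall>x\<in>S. f field_differentiable at x"
    using assms(2) field_differentiable_def by blast
  show "differentiable_upto n S (deriv f)"
    by (rule differentiable_upto_cong[OF assms(1) _ assms(3)])
       (simp add: DERIV_imp_deriv[symmetric] assms(2))
qed

lemma differentiable_upto_Suc_has_deriv:
  assumes "differentiable_upto (Suc n) S f" "x \<in> S"
  shows "(f has_real_derivative deriv f x) (at x)"
  using assms by (simp add: differentiable_upto_Suc DERIV_deriv_iff_field_differentiable)

section \<open>Closure under sums, products and composition\<close>

lemma differentiable_upto_add:
  assumes "open S" "differentiable_upto n S f" "differentiable_upto n S g"
  shows "differentiable_upto n S (\<lambda>x. f x + g x)"
  using assms(2,3)
proof (induction n arbitrary: f g)
  case (Suc n)
  show ?case
  proof (rule differentiable_upto_SucI[OF assms(1)])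
    show "((\<lambda>x. f x + g x) has_real_derivative deriv f x + deriv g x) (at x)" if "x \<in> S" for x
      using Suc.prems that by (intro DERIV_add differentiable_upto_Suc_has_deriv)
    show "differentiable_upto n S (\<lambda>x. deriv f x + deriv g x)"
      using Suc by (simp add: differentiable_upto_Suc)
  qed
qed simp

lemma differentiable_upto_mult:
  assumes "open S" "differentiable_upto n S f" "differentiable_upto n S g"
  shows "differentiable_upto n S (\<lambda>x. f x * g x)"
  using assms(2,3)
proof (induction n arbitrary: f g)
  case (Suc n)
  show ?case
  proof (rule differentiable_upto_SucI[OF assms(1)])
    show "((\<lambda>x. f x * g x) has_real_derivative deriv f x * g x + deriv g x * f x) (at x)"
      if "x \<in> S" for x
      using Suc.prems that by (intro DERIV_mult differentiable_upto_Suc_has_deriv)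
    show "differentiable_upto n S (\<lambda>x. deriv f x * g x + deriv g x * f x)"
      using Suc.prems by (intro differentiable_upto_add Suc.IH assms(1) differentiable_upto_SucD[of n S f]
            differentiable_upto_SucD[of n S g]) (auto simp: differentiable_upto_Suc)
  qed
qed simp

lemma differentiable_upto_compose:
  assumes "open S" "differentiable_upto n S f" "differentiable_upto n T g" "f ` S \<subseteq> T"
  shows "differentiable_upto n S (\<lambda>x. g (f x))"
  using assms(2,3)
proof (induction n arbitrary: g)
  case (Suc n)
  show ?case
  proof (rule differentiable_upto_SucI[OF assms(1)])
    show "((\<lambda>x. g (f x)) has_real_derivative deriv g (f x) * deriv f x) (at x)"
      if "x \<in> S" for x
      using Suc.prems that assms(4)
      by (intro DERIV_chain2 differentiable_upto_Suc_has_deriv) auto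
    \<comment> \<open>The induction keeps the inner function fixed and replaces \<open>g\<close> by
      \<open>deriv g\<close>.\<close>
    show "differentiable_upto n S (\<lambda>x. deriv g (f x) * deriv f x)"
      using Suc.prems Suc.IH[of "deriv g"] differentiable_upto_SucD[of n S f]
      by (intro differentiable_upto_mult[OF assms(1)]) (auto simp: differentiable_upto_Suc)
  qed
qed simp

lemma smooth_on_has_deriv:
  assumes "smooth_on S f" "x \<in> S"
  shows "(f has_real_derivative deriv f x) (at x)"
proof (rule differentiable_upto_Suc_has_deriv)
  show "differentiable_upto (Suc 0) S f"
    using assms(1) by (simp only: smooth_on_iff_differentiable_upto)
qed (rule assms(2))

lemma smooth_on_deriv:
  assumes "smooth_on S f"
  shows "smooth_on S (deriv f)"
  unfolding smooth_on_iff_differentiable_upto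
proof
  fix n
  have "differentiable_upto (Suc n) S f"
    using assms by (simp only: smooth_on_iff_differentiable_upto)
  then show "differentiable_upto n S (deriv f)"
    by (simp add: differentiable_upto_Suc)
qed

lemma smooth_onI_deriv:
  assumes "open S" "\<And>x. x \<in> S \<Longrightarrow> (f has_real_derivative f' x) (at x)" "smooth_on S f'"
  shows "smooth_on S f"
  unfolding smooth_on_iff_differentiable_upto
proof
  fix n
  have "differentiable_upto n S f'"
    using assms(3) by (simp only: smooth_on_iff_differentiable_upto)
  then show "differentiable_upto n S f"
    using differentiable_upto_SucD differentiable_upto_SucI[OF assms(1,2)] by presburger
qed

lemma smooth_on_const: "smooth_on S (\<lambda>_. k)"
proof -
  \<comment> \<open>Proved on the open set \<open>UNIV\<close> and then restricted, as
    \<open>S\<close> is arbitrary here.\<close>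
  have *: "differentiable_upto n UNIV (\<lambda>_. k)" for n
  proof (induction n arbitrary: k)
    case (Suc n)
    then show ?case
      by (intro differentiable_upto_SucI[where f' = "\<lambda>_. 0"]) auto
  qed simp
  then show ?thesis
    unfolding smooth_on_iff_differentiable_upto differentiable_upto_def by blast
qed

lemma smooth_on_id: "open S \<Longrightarrow> smooth_on S (\<lambda>x. x)"
  by (rule smooth_onI_deriv[OF _ DERIV_ident smooth_on_const])

lemma smooth_on_add:
  "open S \<Longrightarrow> smooth_on S f \<Longrightarrow> smooth_on S g \<Longrightarrow> smooth_on S (\<lambda>x. f x + g x)"
  by (simp add: smooth_on_iff_differentiable_upto differentiable_upto_add)

lemma smooth_on_mult:
  "open S \<Longrightarrow> smooth_on S f \<Longrightarrow> smooth_on S g \<Longrightarrow> smooth_on S (\<lambda>x. f x * g x)"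
  by (simp add: smooth_on_iff_differentiable_upto differentiable_upto_mult)

lemma smooth_on_compose:
  assumes "open S" "smooth_on S f" "smooth_on T g" "f ` S \<subseteq> T"
  shows "smooth_on S (\<lambda>x. g (f x))"
  using differentiable_upto_compose[OF assms(1) _ _ assms(4)] assms(2,3)
  by (simp add: smooth_on_iff_differentiable_upto)

text \<open>Bootstrapping: if \<open>f\<close> has order \<open>n\<close>, then so has its
  derivative \<open>\<phi> (f x)\<close>, and hence \<open>f\<close> has order
  \<open>n + 1\<close>.\<close>

lemma smooth_on_autonomous_ode:
  assumes "open S" "smooth_on T \<phi>" "f ` S \<subseteq> T"
    and "\<And>x. x \<in> S \<Longrightarrow> (f has_real_derivative \<phi> (f x)) (at x)"
  shows "smooth_on S f"
  unfolding smooth_on_iff_differentiable_upto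
proof
  fix n show "differentiable_upto n S f"
  proof (induction n)
    case (Suc n)
    show ?case
      using assms(2)
      by (intro differentiable_upto_SucI[OF assms(1,4)] differentiable_upto_compose[OF assms(1) Suc _ assms(3)])
         (auto simp: smooth_on_iff_differentiable_upto)
  qed simp
qed

section \<open>Smoothness of reciprocals and of the square root\<close>

lemma smooth_on_inverse:
  assumes "open S" "0 \<notin> S"
  shows "smooth_on S inverse"
\<comment> \<open>The reciprocal solves \<open>y' = - y^2\<close>, whose right-hand side is a
  polynomial.\<close>
proof (rule smooth_on_autonomous_ode[where T = UNIV and \<phi> = "\<lambda>y. (-1) * (y * y)"])
  show "smooth_on UNIV (\<lambda>y::real. (-1) * (y * y))"
    by (intro smooth_on_mult smooth_on_const smooth_on_id) auto
  show "(inverse has_real_derivative (-1) * (inverse x * inverse x)) (at x)" if "x \<in> S" for x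
    using DERIV_inverse[of x UNIV] that assms(2) by (auto simp: power2_eq_square)
qed (use assms in auto)

lemma smooth_on_inverse_affine:
  assumes "open S" "\<And>x. x \<in> S \<Longrightarrow> 0 < a * x + c"
  shows "smooth_on S (\<lambda>x. inverse (a * x + c))"
proof (rule smooth_on_compose[OF assms(1), where T = "{0<..}" and g = inverse])
  show "smooth_on S (\<lambda>x. a * x + c)"
    using assms(1) by (intro smooth_on_add smooth_on_mult smooth_on_const smooth_on_id)
  show "smooth_on {0<..} inverse"
    by (intro smooth_on_inverse) auto
qed (use assms(2) in auto)

lemma smooth_on_sqrt: "smooth_on {0<..} sqrt"
\<comment> \<open>The square root solves \<open>y' = 1 / (2 y)\<close> and stays positive.\<close>
proof (rule smooth_on_autonomous_ode[where T = "{0<..}" and \<phi> = "\<lambda>y. inverse y * (1 / 2)"])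
  show "smooth_on {0<..} (\<lambda>y::real. inverse y * (1 / 2))"
    by (intro smooth_on_mult smooth_on_const smooth_on_inverse) auto
  show "(sqrt has_real_derivative inverse (sqrt x) * (1 / 2)) (at x)" if "x \<in> {0<..}" for x
    using DERIV_real_sqrt[of x] that by simp
qed auto

subsection \<open>Geometry of rotational surfaces\<close>

lemma has_vector_derivative_vector_3:
  assumes "(p has_real_derivative p') (at u)" "(q has_real_derivative q') (at u)"
    and "(r has_real_derivative r') (at u)"
  shows "((\<lambda>t. vector [p t, q t, r t] :: real^3) has_vector_derivative vector [p', q', r']) (at u)"
proof -
  have "(\<lambda>t. vector [p t, q t, r t] :: real^3) =
      (\<lambda>t. p t *\<^sub>R axis 1 1 + q t *\<^sub>R axis 2 1 + r t *\<^sub>R axis 3 1)"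
    by (rule ext) (simp add: vec_eq_iff forall_3 axis_def)
  moreover have "(vector [p', q', r'] :: real^3) = p' *\<^sub>R axis 1 1 + q' *\<^sub>R axis 2 1 + r' *\<^sub>R axis 3 1"
    by (simp add: vec_eq_iff forall_3 axis_def)
  ultimately show ?thesis
    using assms by (auto intro!: derivative_eq_intros simp: has_real_derivative_iff_has_vector_derivative)
qed

lemmas vector_derivative_vector_3 = vector_derivative_at[OF has_vector_derivative_vector_3]

text \<open>The formulas for the geometric quantities hold only for parameters in the open interval
  \<open>I\<close>; this suffices to differentiate them in the first variable.\<close>

lemma partial1_eqI:
  assumes "open S" "u \<in> S" "\<And>t. t \<in> S \<Longrightarrow> X t v = p t" "(p has_vector_derivative D) (at u)"
  shows "partial1 X u v = D"
  unfolding partial1_def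
  by (rule vector_derivative_at, rule has_vector_derivative_transform_within_open[OF assms(4,1,2)])
     (simp add: assms(3))

lemmas partial1_real_eqI = partial1_eqI[OF _ _ _ has_real_derivative_iff_has_vector_derivative[THEN iffD1]]

text \<open>Expresses rotational symmetry: quantities independent of the angle have no angular
  derivative.\<close>

lemma partial2_constI:
  assumes "\<And>t. X u t = k"
  shows "partial2 X u v = 0"
proof -
  have "X u = (\<lambda>_. k)"
    using assms by blast
  then show ?thesis
    by (simp add: partial2_def)
qed

locale profile =
  fixes I :: "real set" and f g :: "real \<Rightarrow> real"
  assumes rotational_profile: "rotational_profile I f g"
begin

lemma open_I: "open I" and interval_I: "is_interval I" and nonempty_I: "I \<noteq> {}"
  and smooth_f: "smooth_on I f" and smooth_g: "smooth_on I g"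
  using rotational_profile by (auto simp: rotational_profile_def open_interval_def)

lemma f_pos: "s \<in> I \<Longrightarrow> f s > 0"
  and unit_speed: "s \<in> I \<Longrightarrow> (deriv f s)\<^sup>2 + (deriv g s)\<^sup>2 = 1"
  using rotational_profile by (auto simp: rotational_profile_def)

lemmas f_has_deriv = smooth_on_has_deriv[OF smooth_f]
  and f'_has_deriv = smooth_on_has_deriv[OF smooth_on_deriv[OF smooth_f]]
  and g_has_deriv = smooth_on_has_deriv[OF smooth_g]
  and g'_has_deriv = smooth_on_has_deriv[OF smooth_on_deriv[OF smooth_g]]

lemma deriv_unit_speed:
  assumes "s \<in> I"
  shows "deriv f s * deriv (deriv f) s + deriv g s * deriv (deriv g) s = 0"
proof -
  have "((\<lambda>s. (deriv f s)\<^sup>2 + (deriv g s)\<^sup>2) has_real_derivative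
      2 * (deriv f s * deriv (deriv f) s + deriv g s * deriv (deriv g) s)) (at s)"
    by (auto intro!: derivative_eq_intros f'_has_deriv g'_has_deriv assms)
  moreover have "((\<lambda>s. (deriv f s)\<^sup>2 + (deriv g s)\<^sup>2) has_real_derivative 0) (at s)"
    by (rule has_field_derivative_transform_within_open[OF DERIV_const open_I assms])
       (simp add: unit_speed)
  ultimately show ?thesis
    using DERIV_unique by fastforce
qed

section \<open>First and second partial derivatives of the parametrisation\<close>

lemma partial1_rot_param:
  "s \<in> I \<Longrightarrow> partial1 (rot_param f g) s \<theta> =
     vector [deriv f s * cos \<theta>, deriv f s * sin \<theta>, deriv g s]"
  unfolding partial1_def rot_param_def
  by (intro vector_derivative_vector_3) (auto intro!: derivative_eq_intros f_has_deriv g_has_deriv)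

lemma partial2_rot_param:
  "partial2 (rot_param f g) s \<theta> = vector [- f s * sin \<theta>, f s * cos \<theta>, 0]"
  unfolding partial2_def rot_param_def
  by (intro vector_derivative_vector_3) (auto intro!: derivative_eq_intros)

lemma partial1_partial1_rot_param:
  assumes "s \<in> I"
  shows "partial1 (partial1 (rot_param f g)) s \<theta> =
     vector [deriv (deriv f) s * cos \<theta>, deriv (deriv f) s * sin \<theta>, deriv (deriv g) s]"
proof (rule partial1_eqI[OF open_I assms])
  show "partial1 (rot_param f g) t \<theta> = vector [deriv f t * cos \<theta>, deriv f t * sin \<theta>, deriv g t]"
    if "t \<in> I" for t
    using that by (rule partial1_rot_param)
qed (use assms in \<open>auto intro!: has_vector_derivative_vector_3 derivative_eq_intros f'_has_deriv g'_has_deriv\<close>)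

lemma partial2_partial1_rot_param:
  assumes "s \<in> I"
  shows "partial2 (partial1 (rot_param f g)) s \<theta> = vector [- deriv f s * sin \<theta>, deriv f s * cos \<theta>, 0]"
proof -
  have "partial1 (rot_param f g) s = (\<lambda>\<theta>. vector [deriv f s * cos \<theta>, deriv f s * sin \<theta>, deriv g s])"
    using partial1_rot_param[OF assms] by blast
  then show ?thesis
    unfolding partial2_def
    by (simp only:, intro vector_derivative_vector_3) (auto intro!: derivative_eq_intros)
qed

lemma partial2_partial2_rot_param:
  "partial2 (partial2 (rot_param f g)) s \<theta> = vector [- f s * cos \<theta>, - f s * sin \<theta>, 0]"
  unfolding partial2_def[of "partial2 (rot_param f g)"] partial2_rot_param
  by (intro vector_derivative_vector_3) (auto intro!: derivative_eq_intros)

section \<open>Metric, unit normal and Gaussian curvature\<close>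

lemma metric_rot_param:
  assumes "s \<in> I"
  shows "metric_E (rot_param f g) s \<theta> = 1" "metric_F (rot_param f g) s \<theta> = 0"
    and "metric_G (rot_param f g) s \<theta> = (f s)\<^sup>2" "metric_det (rot_param f g) s \<theta> = (f s)\<^sup>2"
proof -
  have "(x * cos \<theta>)\<^sup>2 + (x * sin \<theta>)\<^sup>2 = x\<^sup>2" for x
    by (simp add: power_mult_distrib flip: distrib_left)
  then have *: "x * cos \<theta> * (x * cos \<theta>) + x * sin \<theta> * (x * sin \<theta>) = x * x" for x
    by (simp add: power2_eq_square)
  show E: "metric_E (rot_param f g) s \<theta> = 1"
    using unit_speed[OF assms]
    by (simp add: metric_E_def partial1_rot_param assms inner_vec_def sum_3 * power2_eq_square)
  show F: "metric_F (rot_param f g) s \<theta> = 0"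
    by (simp add: metric_F_def partial1_rot_param partial2_rot_param assms inner_vec_def sum_3)
  show G: "metric_G (rot_param f g) s \<theta> = (f s)\<^sup>2"
    using *[of "f s"]
    by (simp add: metric_G_def partial2_rot_param assms inner_vec_def sum_3 power2_eq_square)
  show "metric_det (rot_param f g) s \<theta> = (f s)\<^sup>2"
    by (simp add: metric_det_def E F G)
qed

lemma surface_normal_rot_param:
  assumes "s \<in> I"
  shows "surface_normal (rot_param f g) s \<theta> =
     vector [- deriv g s * cos \<theta>, - deriv g s * sin \<theta>, deriv f s]"
proof -
  let ?n = "vector [- deriv g s * cos \<theta>, - deriv g s * sin \<theta>, deriv f s] :: real^3"
  have trig: "x * (cos \<theta> * cos \<theta>) + x * (sin \<theta> * sin \<theta>) = x" for x
    using sin_cos_squared_add3[of \<theta>] by (simp flip: distrib_left)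
  \<comment> \<open>The cross product is the positive number \<open>f s\<close> times a vector which
    has norm 1 by unit speed, so \<open>sgn\<close> just removes the factor.\<close>
  have "cross3 (partial1 (rot_param f g) s \<theta>) (partial2 (rot_param f g) s \<theta>) = f s *\<^sub>R ?n"
    using trig[of "f s * deriv f s"]
    by (simp add: partial1_rot_param partial2_rot_param assms cross3_def vec_eq_iff forall_3 algebra_simps)
  moreover have "norm ?n = 1"
    using unit_speed[OF assms] trig[of "deriv g s * deriv g s"]
    by (simp add: norm_eq_1 inner_vec_def sum_3 power2_eq_square algebra_simps)
  ultimately show ?thesis
    using f_pos[OF assms] by (simp add: surface_normal_def sgn_div_norm)
qed

lemma gaussian_curvature_rot_param:
  assumes "s \<in> I"
  shows "gaussian_curvature (rot_param f g) s \<theta> = - deriv (deriv f) s / f s"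
proof -
  have trig: "x * (cos \<theta> * cos \<theta>) + x * (sin \<theta> * sin \<theta>) = x" for x
    using sin_cos_squared_add3[of \<theta>] by (simp flip: distrib_left)
  let ?n = "surface_normal (rot_param f g) s \<theta>"
  have "partial1 (partial1 (rot_param f g)) s \<theta> \<bullet> ?n =
      deriv f s * deriv (deriv g) s - deriv g s * deriv (deriv f) s"
    using trig[of "deriv g s * deriv (deriv f) s"]
    by (simp add: partial1_partial1_rot_param surface_normal_rot_param assms inner_vec_def sum_3 algebra_simps)
  moreover have "partial2 (partial2 (rot_param f g)) s \<theta> \<bullet> ?n = f s * deriv g s"
    using trig[of "f s * deriv g s"]
    by (simp add: partial2_partial2_rot_param surface_normal_rot_param assms inner_vec_def sum_3 algebra_simps)
  moreover have "partial2 (partial1 (rot_param f g)) s \<theta> \<bullet> ?n = 0"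
    by (simp add: partial2_partial1_rot_param surface_normal_rot_param assms inner_vec_def sum_3 algebra_simps)
  \<comment> \<open>The differentiated unit-speed identity replaces \<open>g' g''\<close> by
    \<open>- f' f''\<close>, and \<open>f'^2 + g'^2 = 1\<close> finishes. There is no division by
    \<open>g'\<close>, which may vanish.\<close>
  moreover have "(deriv f s * deriv (deriv g) s - deriv g s * deriv (deriv f) s) * deriv g s =
      - deriv (deriv f) s"
    using unit_speed[OF assms] deriv_unit_speed[OF assms] by algebra
  ultimately show ?thesis
    using f_pos[OF assms]
    by (simp add: gaussian_curvature_def metric_rot_param assms power2_eq_square mult.assoc
        mult.commute[of "deriv g s"] mult.left_commute[of _ "deriv g s"] mult.left_commute[of _ "f s"])
qed

section \<open>Curvature and Ricci condition under the equation
  \<open>f' = a + c / f\<close>\<close>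

lemma gaussian_curvature_ode:
  assumes f': "\<And>s. s \<in> I \<Longrightarrow> (f has_real_derivative a + c / f s) (at s)" and s: "s \<in> I"
  shows "gaussian_curvature (rot_param f g) s \<theta> = c * (a * f s + c) / f s ^ 4"
proof -
  have "deriv (deriv f) s = - c * (a * f s + c) / f s ^ 3"
  proof (rule DERIV_imp_deriv, rule has_field_derivative_transform_within_open[OF _ open_I s])
    show "((\<lambda>t. a + c / f t) has_real_derivative - c * (a * f s + c) / f s ^ 3) (at s)"
      using f_pos[OF s]
      by (auto intro!: derivative_eq_intros f'[OF s] simp: field_simps eval_nat_numeral)
  qed (simp add: DERIV_imp_deriv[OF f'])
  then show ?thesis
    using f_pos[OF s] by (simp add: gaussian_curvature_rot_param s field_simps eval_nat_numeral)
qed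

lemma ricci_condition_rot_param:
  assumes f': "\<And>s. s \<in> I \<Longrightarrow> (f has_real_derivative a + c / f s) (at s)" and s: "s \<in> I"
  shows "ricci_condition_at (rot_param f g) s \<theta>"
proof -
  let ?X = "rot_param f g"
  define K where "K t = c * (a * f t + c) / f t ^ 4" for t
  \<comment> \<open>\<open>K1\<close> and \<open>K2\<close> are the first and second derivatives of
    \<open>K\<close> along the profile, with \<open>f'\<close> eliminated by means of the
    equation.\<close>
  define K1 where "K1 t = - c * (a * f t + c) * (3 * a * f t + 4 * c) / f t ^ 6" for t
  define K2 where "K2 t = c * (a * f t + c) *
      (12 * a\<^sup>2 * (f t)\<^sup>2 + 35 * a * c * f t + 24 * c\<^sup>2) / f t ^ 8" for t
  have K: "gaussian_curvature ?X t v = K t" if "t \<in> I" for t v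
    unfolding K_def by (rule gaussian_curvature_ode[OF f' that])
  have K': "(K has_real_derivative K1 t) (at t)" if "t \<in> I" for t
    unfolding K_def[abs_def] K1_def using f_pos[OF that]
    by (auto intro!: derivative_eq_intros f'[OF that] simp: field_simps eval_nat_numeral)
  have K1': "(K1 has_real_derivative K2 t) (at t)" if "t \<in> I" for t
    unfolding K1_def[abs_def] K2_def using f_pos[OF that]
    by (auto intro!: derivative_eq_intros f'[OF that] simp: field_simps eval_nat_numeral)
  have p1: "partial1 (gaussian_curvature ?X) t v = K1 t" if "t \<in> I" for t v
    by (rule partial1_real_eqI[OF open_I that K K'[OF that]])
  have p2: "partial2 (gaussian_curvature ?X) t v = 0" if "t \<in> I" for t v
    by (rule partial2_constI) (rule K[OF that])
  \<comment> \<open>For the metric \<open>ds^2 + f^2 d\<theta>^2\<close> the Laplacian of a function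
    of \<open>s\<close> is \<open>K'' + (f' / f) K'\<close>.\<close>
  have "laplace_beltrami ?X (gaussian_curvature ?X) s \<theta> = K2 s + (a + c / f s) / f s * K1 s"
  proof -
    have "partial1 (\<lambda>u v. (metric_G ?X u v * partial1 (gaussian_curvature ?X) u v
          - metric_F ?X u v * partial2 (gaussian_curvature ?X) u v) / sqrt (metric_det ?X u v)) s \<theta>
        = (a + c / f s) * K1 s + f s * K2 s"
    proof (rule partial1_real_eqI[OF open_I s])
      show "((\<lambda>t. f t * K1 t) has_real_derivative (a + c / f s) * K1 s + f s * K2 s) (at s)"
        by (auto intro!: derivative_eq_intros f' K1' s)
    qed (use f_pos in \<open>simp add: metric_rot_param p1 p2 power2_eq_square real_sqrt_mult abs_of_pos\<close>)
    moreover have "partial2 (\<lambda>u v. (metric_E ?X u v * partial2 (gaussian_curvature ?X) u v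
          - metric_F ?X u v * partial1 (gaussian_curvature ?X) u v) / sqrt (metric_det ?X u v)) s \<theta> = 0"
      by (rule partial2_constI[where k = 0]) (simp add: metric_rot_param p2 s)
    ultimately show ?thesis
      using f_pos[OF s] by (simp add: laplace_beltrami_def metric_rot_param s field_simps)
  qed
  moreover have "grad_norm_sq ?X (gaussian_curvature ?X) s \<theta> = (K1 s)\<^sup>2"
    using f_pos[OF s] by (simp add: grad_norm_sq_def metric_rot_param p1 p2 s)
  \<comment> \<open>Apart from the factor \<open>c^2 (a f + c)^2 / f^12\<close>, a quadratic form in
    \<open>a f\<close> and \<open>c\<close> remains, and all its coefficients cancel.\<close>
  moreover have "K s * (K2 s + (a + c / f s) / f s * K1 s) - (K1 s)\<^sup>2 - 4 * K s ^ 3 = 0"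
    using f_pos[OF s] unfolding K_def K1_def K2_def
    by (simp add: field_simps eval_nat_numeral)
  ultimately show ?thesis
    by (simp add: ricci_condition_at_def Let_def K s)
qed

end

subsection \<open>Profiles given by the implicit equation\<close>

text \<open>An affine function attains its minimum on an interval at an end point, the left one if
  \<open>m \<ge> 0\<close> and the right one otherwise.\<close>

lemma affine_pos_between:
  fixes m k :: real
  assumes "0 < m * x + k" "0 < m * y + k" "x \<le> t" "t \<le> y"
  shows "0 < m * t + k"
proof (cases "m \<ge> 0")
  case True
  then show ?thesis
    using assms(1) mult_left_mono[OF assms(3)] by fastforce
next
  case False
  then show ?thesis
    using assms(2) mult_left_mono_neg[OF assms(4), of m] by linarith
qed

text \<open>The implicit equation solved for \<open>s\<close>, with \<open>x\<close> in place of \<open>f s\<close>.\<close>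

definition arclength :: "real \<Rightarrow> real \<Rightarrow> real \<Rightarrow> real \<Rightarrow> real" where
  "arclength a c d x = (a * x - c * ln (a * x + c) - d) / a\<^sup>2"

text \<open>The numerator has derivative
  \<open>a - a c / (a x + c) = a^2 x / (a x + c)\<close>.\<close>

lemma arclength_has_deriv:
  assumes "a \<noteq> 0" "0 < a * x + c"
  shows "(arclength a c d has_real_derivative x / (a * x + c)) (at x)"
  unfolding arclength_def[abs_def] using assms
  by (auto intro!: derivative_eq_intros simp: power2_eq_square divide_simps) (simp add: algebra_simps)

lemma arclength_strict_mono:
  assumes "a \<noteq> 0" "0 < x" "x < y" "0 < a * x + c" "0 < a * y + c"
  shows "arclength a c d x < arclength a c d y"
proof (rule DERIV_pos_imp_increasing[OF \<open>x < y\<close>])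
  fix t assume t: "x \<le> t" "t \<le> y"
  then have "0 < a * t + c"
    using affine_pos_between assms(4,5) by blast
  then show "\<exists>D. (arclength a c d has_real_derivative D) (at t) \<and> 0 < D"
    using arclength_has_deriv[OF assms(1)] assms(2) t by fastforce
qed

text \<open>Turns the implicit equation into the statement that \<open>arclength\<close> is a left
  inverse of \<open>f\<close> on \<open>I\<close>.\<close>

lemma implicitly_defined_iff:
  "a \<noteq> 0 \<Longrightarrow> implicitly_defined a c d I f \<longleftrightarrow> (\<forall>s\<in>I. 0 < a * f s + c \<and> arclength a c d (f s) = s)"
  by (auto simp: implicitly_defined_def arclength_def field_simps)

text \<open>The values at which the slope \<open>a + c / x\<close> prescribed by the implicit equation lies
  strictly between 0 and 1.\<close>

definition profile_range :: "real \<Rightarrow> real \<Rightarrow> real set" where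
  "profile_range a c = {x. 0 < x \<and> 0 < a * x + c \<and> 0 < (1 - a) * x - c}"

lemma open_profile_range: "open (profile_range a c)"
  unfolding profile_range_def by (intro open_Collect_conj open_Collect_less continuous_intros)

lemma is_interval_profile_range: "is_interval (profile_range a c)"
  unfolding is_interval_1 profile_range_def
proof clarsimp
  fix x y t
  assume *: "0 < x" "0 < a * x + c" "c < (1 - a) * x" "0 < a * y + c" "c < (1 - a) * y" "x \<le> t" "t \<le> y"
  then show "0 < a * t + c \<and> c < (1 - a) * t"
    using affine_pos_between[of a x c y t] affine_pos_between[of "1 - a" x "- c" y t] by simp
qed

lemma arclength_strict_mono_on:
  "a \<noteq> 0 \<Longrightarrow> strict_mono_on (profile_range a c) (arclength a c d)"
  by (rule strict_mono_onI) (auto simp: profile_range_def intro: arclength_strict_mono)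

lemma slope_profile_range:
  assumes "x \<in> profile_range a c"
  shows "0 < a + c / x" "a + c / x < 1"
  using assms by (auto simp: profile_range_def field_simps)

text \<open>The derivative of \<open>arclength\<close> is the reciprocal of the prescribed slope;
  used to differentiate its inverse and to change variables.\<close>

lemma arclength_slope:
  assumes "x \<in> profile_range a c"
  shows "x / (a * x + c) * (a + c / x) = 1"
proof -
  have "a + c / x = (a * x + c) / x"
    using assms by (simp add: profile_range_def add_divide_distrib)
  then show ?thesis
    using assms by (simp add: profile_range_def)
qed

locale implicit_profile = profile +
  fixes a c d :: real
  assumes a_nonzero: "a \<noteq> 0" and c_nonzero: "c \<noteq> 0"
    and implicitly_defined: "implicitly_defined a c d I f"
begin

lemma arclength_f: "s \<in> I \<Longrightarrow> arclength a c d (f s) = s"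
  and affine_f_pos: "s \<in> I \<Longrightarrow> 0 < a * f s + c"
  using implicitly_defined by (auto simp: implicitly_defined_iff a_nonzero)

text \<open>Differentiate \<open>arclength a c d (f s) = s\<close> on the open interval
  \<open>I\<close>.\<close>

lemma deriv_f:
  assumes "s \<in> I"
  shows "deriv f s = a + c / f s"
proof -
  have "((\<lambda>s. arclength a c d (f s)) has_real_derivative f s / (a * f s + c) * deriv f s) (at s)"
    by (intro DERIV_chain2[OF arclength_has_deriv] a_nonzero affine_f_pos f_has_deriv assms)
  moreover have "((\<lambda>s. arclength a c d (f s)) has_real_derivative 1) (at s)"
    by (rule has_field_derivative_transform_within_open[OF DERIV_ident open_I assms])
       (simp add: arclength_f)
  ultimately have "f s / (a * f s + c) * deriv f s = 1"
    by (rule DERIV_unique)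
  then show ?thesis
    using f_pos[OF assms] affine_f_pos[OF assms] by (simp add: field_simps)
qed

lemma f_ode: "s \<in> I \<Longrightarrow> (f has_real_derivative a + c / f s) (at s)"
  using f_has_deriv deriv_f by metis

lemma gaussian_curvature_f:
  "s \<in> I \<Longrightarrow> gaussian_curvature (rot_param f g) s \<theta> = c * (a * f s + c) / f s ^ 4"
  by (rule gaussian_curvature_ode[OF f_ode])

text \<open>Unit speed only gives \<open>f' \<le> 1\<close>. Where \<open>f' = 1\<close> the slope would be maximal,
  forcing \<open>f'' = 0\<close>, but the ODE gives \<open>K \<noteq> 0\<close>.\<close>

lemma deriv_f_less_1:
  assumes "s \<in> I"
  shows "deriv f s < 1"
proof (rule ccontr)
  have le: "deriv f t \<le> 1" if "t \<in> I" for t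
    using unit_speed[OF that] abs_le_square_iff[of "deriv f t" 1] zero_le_power2[of "deriv g t"]
    by (simp del: zero_le_power2)
  assume "\<not> deriv f s < 1"
  then have "deriv f s = 1"
    using le[OF assms] by simp
  obtain e where "0 < e" "\<And>t. dist t s < e \<Longrightarrow> t \<in> I"
    using open_I assms by (auto simp: open_dist)
  then have "deriv (deriv f) s = 0"
    using le \<open>deriv f s = 1\<close>
    by (intro DERIV_local_max[OF f'_has_deriv[OF assms] \<open>0 < e\<close>]) (auto simp: dist_real_def abs_minus_commute)
  then show False
    using gaussian_curvature_f[OF assms] f_pos[OF assms] affine_f_pos[OF assms] c_nonzero
    by (simp add: gaussian_curvature_rot_param assms)
qed

lemma f_in_profile_range: "s \<in> I \<Longrightarrow> f s \<in> profile_range a c"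
  using deriv_f_less_1[of s] f_pos[of s] affine_f_pos[of s]
  by (simp add: deriv_f profile_range_def field_simps)

lemma strict_mono_on_f: "strict_mono_on I f"
proof (rule strict_mono_onI)
  fix s t assume "s \<in> I" "t \<in> I" "s < t"
  then show "f s < f t"
    using arclength_strict_mono[OF a_nonzero f_pos, of t "f s" c d] arclength_f affine_f_pos
    by (metis linorder_neqE_linordered_idom less_asym)
qed

lemma diffeomorphism_on_f: "diffeomorphism_on I (f ` I) f"
proof -
  have inj: "inj_on f I"
    using strict_mono_on_f strict_mono_on_imp_inj_on by blast
  have "continuous_on I f"
    using f_ode DERIV_isCont continuous_at_imp_continuous_on by blast
  \<comment> \<open>A continuous injective map of an open subset of the line is open.\<close>
  then have open_image: "open (f ` I)"
    using injective_into_1d_imp_open_map_UNIV[OF open_I _ inj] by simp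
  \<comment> \<open>On the image the inverse of \<open>f\<close> is \<open>arclength\<close>, whose
    derivative is rational in \<open>x\<close>.\<close>
  have "smooth_on (f ` I) (arclength a c d)"
  proof (rule smooth_onI_deriv[OF open_image])
    have "smooth_on (f ` I) (\<lambda>x. inverse (a * x + c))"
      by (rule smooth_on_inverse_affine[OF open_image]) (use affine_f_pos in auto)
    then show "smooth_on (f ` I) (\<lambda>x. x * inverse (a * x + c))"
      by (intro smooth_on_mult smooth_on_id open_image)
    show "(arclength a c d has_real_derivative x * inverse (a * x + c)) (at x)" if "x \<in> f ` I" for x
      using arclength_has_deriv[OF a_nonzero, of x c d] affine_f_pos that by (auto simp: divide_inverse)
  qed
  then have "smooth_on (f ` I) (the_inv_into I f)"
    by (rule smooth_on_cong[OF open_image, rotated]) (auto simp: the_inv_into_f_f inj arclength_f)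
  then show ?thesis
    using inj open_I open_image smooth_f by (auto simp: diffeomorphism_on_def bij_betw_def)
qed

end

lemma implicit_profileI:
  assumes "rotational_ricci I f g" "a \<noteq> 0" "c \<noteq> 0" "implicitly_defined a c d I f"
  shows "implicit_profile I f g a c d"
  using assms by unfold_locales (auto simp: rotational_ricci_def)

subsection \<open>The maximal profile for \<open>c < 0\<close>\<close>

locale asymptotic_profile =
  fixes a c d :: real
  assumes a_pos: "0 < a" and c_neg: "c < 0"
begin

abbreviation "D \<equiv> profile_range a c"
text \<open>The candidate \<open>(J, h)\<close> for the greatest extension depends on
  \<open>a\<close>, \<open>c\<close> and \<open>d\<close> only, so the same pair dominates every
  admissible profile.\<close>

definition J :: "real set" where "J = arclength a c d ` D"
definition h :: "real \<Rightarrow> real" where "h = the_inv_into D (arclength a c d)"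

text \<open>Makes the end points explicit, in the form that \<open>einterval_antiderivative\<close>
  expects. For \<open>a \<le> 1\<close> the condition of slope below 1 is automatic because
  \<open>c < 0\<close>.\<close>

lemma D_eq_einterval:
  "x \<in> D \<longleftrightarrow> ereal (- c / a) < ereal x \<and> ereal x < (if a \<le> 1 then \<infinity> else ereal (c / (1 - a)))"
proof -
  have "0 < a * x + c \<longleftrightarrow> - c / a < x"
    using pos_divide_less_eq[OF a_pos, of "- c" x] by (auto simp: mult.commute)
  moreover have "0 < x" if "- c / a < x"
    using that a_pos c_neg by (meson divide_pos_pos less_trans neg_0_less_iff_less)
  moreover have "0 < (1 - a) * x - c" if "a \<le> 1" "0 < x"
    using that c_neg by (smt (verit) mult_nonneg_nonneg)
  moreover have "0 < (1 - a) * x - c \<longleftrightarrow> x < c / (1 - a)" if "\<not> a \<le> 1"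
    using that neg_less_divide_eq[of "1 - a" x c] by (simp add: mult.commute)
  ultimately show ?thesis
    unfolding profile_range_def by (cases "a \<le> 1") (simp, metis)+
qed

lemma einterval_nonempty: "ereal (- c / a) < (if a \<le> 1 then \<infinity> else ereal (c / (1 - a)))"
proof (cases "a \<le> 1")
  case False
  then have "- c / a < - c / (a - 1)"
    using c_neg by (intro divide_strict_left_mono) auto
  also have "- c / (a - 1) = c / (1 - a)"
    using minus_divide_divide[of c "1 - a"] by simp
  finally show ?thesis
    using False by simp
qed simp

section \<open>The inverse \<open>h\<close> of \<open>arclength\<close> on \<open>D\<close> and its
  differential equation\<close>

lemma inj_on_arclength: "inj_on (arclength a c d) D"
  by (rule strict_mono_on_imp_inj_on[OF arclength_strict_mono_on]) (use a_pos in simp)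

lemma continuous_on_arclength: "continuous_on D (arclength a c d)"
  using a_pos
  by (intro continuous_at_imp_continuous_on ballI DERIV_isCont[OF arclength_has_deriv])
     (auto simp: profile_range_def)

lemma open_J: "open J"
  unfolding J_def
  by (rule injective_into_1d_imp_open_map_UNIV[OF open_profile_range continuous_on_arclength
        inj_on_arclength order_refl])

lemma is_interval_J: "is_interval J"
  unfolding J_def is_interval_connected_1
  by (rule connected_continuous_image[OF continuous_on_arclength])
     (simp flip: is_interval_connected_1 add: is_interval_profile_range)

lemma h_arclength: "x \<in> D \<Longrightarrow> h (arclength a c d x) = x"
  by (simp add: h_def the_inv_into_f_f inj_on_arclength)

lemma h_in_D: "s \<in> J \<Longrightarrow> h s \<in> D"
  and arclength_h: "s \<in> J \<Longrightarrow> arclength a c d (h s) = s"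
  by (auto simp: J_def h_arclength)

lemma h_ode:
  assumes "s \<in> J"
  shows "(h has_real_derivative a + c / h s) (at s)"
proof -
  have h: "0 < h s" "0 < a * h s + c"
    using h_in_D[OF assms] by (auto simp: profile_range_def)
  \<comment> \<open>Inverse function theorem at the point \<open>h s\<close> of the open set
    \<open>D\<close>.\<close>
  have "(h has_derivative (*) (a + c / h s)) (at (arclength a c d (h s)))"
  proof (rule has_derivative_inverse_strong[OF open_profile_range h_in_D[OF assms]
        continuous_on_arclength h_arclength])
    show "(arclength a c d has_derivative (*) (h s / (a * h s + c))) (at (h s))"
      using arclength_has_deriv[of a "h s" c d] a_pos h(2) by (simp add: has_field_derivative_def)
    show "(*) (h s / (a * h s + c)) \<circ> (*) (a + c / h s) = id"
      by (rule ext)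
         (simp only: comp_apply id_apply mult.assoc[symmetric] arclength_slope[OF h_in_D[OF assms]] mult_1_left)
  qed
  then show ?thesis
    by (simp add: has_field_derivative_def arclength_h assms)
qed

lemma smooth_on_h: "smooth_on J h"
proof (rule smooth_on_autonomous_ode[OF open_J])
  show "smooth_on {0<..} (\<lambda>x. a + c * inverse x)"
    by (intro smooth_on_add smooth_on_mult smooth_on_const smooth_on_inverse) auto
  show "h ` J \<subseteq> {0<..}"
    using h_in_D by (auto simp: profile_range_def)
  show "(h has_real_derivative a + c * inverse (h s)) (at s)" if "s \<in> J" for s
    using h_ode[OF that] by (simp add: divide_inverse)
qed

section \<open>A height function that completes \<open>h\<close> to a unit-speed profile\<close>

lemma smooth_on_height_slope: "smooth_on D (\<lambda>x. sqrt (1 - (a + c * inverse x)\<^sup>2))"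
proof (rule smooth_on_compose[OF open_profile_range _ smooth_on_sqrt])
  have slope: "smooth_on D (\<lambda>x. a + c * inverse x)"
    by (intro smooth_on_add smooth_on_mult smooth_on_const smooth_on_inverse open_profile_range)
       (auto simp: profile_range_def)
  have "smooth_on D (\<lambda>x. 1 + (-1) * ((a + c * inverse x) * (a + c * inverse x)))"
    by (intro smooth_on_add[OF open_profile_range] smooth_on_mult[OF open_profile_range]
        smooth_on_const slope)
  then show "smooth_on D (\<lambda>x. 1 - (a + c * inverse x)\<^sup>2)"
    by (simp add: power2_eq_square)
  \<comment> \<open>The strict bound keeps the radicand away from 0, where \<open>sqrt\<close> is
    not smooth.\<close>
  have "(a + c * inverse x)\<^sup>2 < 1" if "x \<in> D" for x
    using slope_profile_range[OF that] by (simp add: abs_square_less_1 divide_inverse)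
  then show "(\<lambda>x. 1 - (a + c * inverse x)\<^sup>2) ` D \<subseteq> {0<..}"
    by auto
qed

text \<open>The height is the integral of \<open>sqrt (1 - h'^2)\<close>, computed with \<open>h\<close> as
  the variable of integration.\<close>

lemma exists_height:
  "\<exists>k. smooth_on J k \<and> (\<forall>s\<in>J. (k has_real_derivative sqrt (1 - (a + c / h s)\<^sup>2)) (at s))"
proof -
  \<comment> \<open>The desired slope of the height, times the factor
    \<open>ds/dx = x / (a x + c)\<close> of the substitution \<open>x = h s\<close>.\<close>
  define w where "w x = sqrt (1 - (a + c * inverse x)\<^sup>2) * (x * inverse (a * x + c))" for x
  have smooth_w: "smooth_on D w"
    unfolding w_def
  proof (intro smooth_on_mult[OF open_profile_range] smooth_on_height_slope smooth_on_id[OF open_profile_range])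
    show "smooth_on D (\<lambda>x. inverse (a * x + c))"
      by (rule smooth_on_inverse_affine[OF open_profile_range]) (simp add: profile_range_def)
  qed
  have "isCont w x" if "x \<in> D" for x
    using smooth_on_has_deriv[OF smooth_w that] by (rule DERIV_isCont)
  then obtain W where "\<forall>x. ereal (- c / a) < ereal x \<longrightarrow>
      ereal x < (if a \<le> 1 then \<infinity> else ereal (c / (1 - a))) \<longrightarrow> (W has_vector_derivative w x) (at x)"
    using einterval_antiderivative[OF einterval_nonempty, of w] D_eq_einterval by blast
  then have W: "(W has_real_derivative w x) (at x)" if "x \<in> D" for x
    using that D_eq_einterval by (simp add: has_real_derivative_iff_has_vector_derivative)
  have "smooth_on J (\<lambda>s. W (h s))"
    using h_in_D by (intro smooth_on_compose[OF open_J smooth_on_h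
          smooth_onI_deriv[OF open_profile_range W smooth_w]]) auto
  moreover have "((\<lambda>s. W (h s)) has_real_derivative sqrt (1 - (a + c / h s)\<^sup>2)) (at s)"
    if s: "s \<in> J" for s
  proof -
    have "w (h s) * (a + c / h s) = sqrt (1 - (a + c / h s)\<^sup>2)"
      by (simp only: w_def divide_inverse[symmetric] mult.assoc arclength_slope[OF h_in_D[OF s]] mult_1_right)
    then show ?thesis
      using DERIV_chain2[OF W[OF h_in_D[OF s]] h_ode[OF s]] by simp
  qed
  ultimately show ?thesis
    by blast
qed

lemma admissible_h:
  assumes "J \<noteq> {}"
  shows "admissible a c d J h"
proof -
  obtain k where k: "smooth_on J k"
    and k': "\<And>s. s \<in> J \<Longrightarrow> (k has_real_derivative sqrt (1 - (a + c / h s)\<^sup>2)) (at s)"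
    using exists_height by blast
  have "rotational_profile J h k"
  proof -
    have "0 < h s \<and> (deriv h s)\<^sup>2 + (deriv k s)\<^sup>2 = 1 \<and> deriv k s \<ge> 0" if s: "s \<in> J" for s
    proof -
      have "0 < h s"
        using h_in_D[OF s] by (simp add: profile_range_def)
      \<comment> \<open>Ensures that the square of \<open>sqrt\<close> in the height slope is its
        radicand.\<close>
      moreover have "(a + c / h s)\<^sup>2 \<le> 1"
        using slope_profile_range[OF h_in_D[OF s]] by (intro power_le_one) auto
      ultimately show ?thesis
        using DERIV_imp_deriv[OF h_ode[OF s]] DERIV_imp_deriv[OF k'[OF s]] by simp
    qed
    then show ?thesis
      using assms open_J is_interval_J smooth_on_h k
      by (auto simp: rotational_profile_def open_interval_def)
  qed
  then interpret profile J h k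
    by unfold_locales
  have "rotational_ricci J h k"
    using rotational_profile ricci_condition_rot_param h_ode by (auto simp: rotational_ricci_def)
  moreover have "implicitly_defined a c d J h"
    using a_pos arclength_h h_in_D by (auto simp: implicitly_defined_iff profile_range_def)
  ultimately show ?thesis
    by (auto simp: admissible_def)
qed

text \<open>An admissible \<open>f\<close> takes values in \<open>D\<close>, where \<open>h\<close>
  inverts \<open>arclength\<close>; so \<open>f s = h s\<close>. Applied to competing extensions as
  well, this gives maximality.\<close>

lemma admissible_extends_to_h:
  assumes "admissible a c d I f"
  shows "extends_to I f J h"
proof -
  obtain g where "rotational_ricci I f g" "implicitly_defined a c d I f"
    using assms by (auto simp: admissible_def)
  then interpret implicit_profile I f g a c d
    using a_pos c_neg by (intro implicit_profileI) auto
  show ?thesis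
    using f_in_profile_range arclength_f h_arclength unfolding extends_to_def J_def
    by (metis image_eqI subsetI)
qed

section \<open>Behaviour of \<open>J\<close> and \<open>h\<close> towards minus infinity\<close>

lemma arclength_unbounded:
  assumes "y \<in> D"
  shows "\<exists>x\<in>D. x < y \<and> arclength a c d x < M"
proof -
  have y: "0 < y" "0 < a * y + c" "0 < (1 - a) * y - c"
    using assms by (auto simp: profile_range_def)
  \<comment> \<open>With \<open>t = a x + c < 1\<close> one has \<open>a x < 1 - c\<close>, so
    \<open>ln t < r\<close> is enough for \<open>a x - c * ln t - d < a\<^sup>2 * M\<close>; here
    \<open>- c > 0\<close>.\<close>
  define r where "r = (a\<^sup>2 * M - 1 + c + d) / (- c)"
  have "\<forall>\<^sub>F t in at_right 0. ln t < r"
    using ln_at_0 by (simp add: filterlim_at_bot_dense)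
  \<comment> \<open>The bound \<open>t < a * y + c\<close> will place \<open>x\<close> below
    \<open>y\<close>.\<close>
  moreover have "\<forall>\<^sub>F t in at_right 0. 0 < t \<and> t < min 1 (a * y + c)"
    using y by (intro eventually_conj eventually_at_right_less)
       (auto simp: eventually_at_right_field intro!: exI[of _ "min 1 (a * y + c)"])
  ultimately have "\<forall>\<^sub>F t in at_right 0. ln t < r \<and> 0 < t \<and> t < min 1 (a * y + c)"
    by eventually_elim blast
  then obtain t where t: "ln t < r" "0 < t" "t < 1" "t < a * y + c"
    using eventually_happens[of _ "at_right (0::real)"] by auto
  define x where "x = (t - c) / a"
  have ax: "a * x + c = t"
    using a_pos by (simp add: x_def)
  have "x < y"
    using t(4) a_pos by (simp add: x_def field_simps)
  have lb: "- c / a < x"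
    using t(2) a_pos by (simp add: x_def field_simps)
  \<comment> \<open>At the left end point \<open>- c / a\<close> this affine expression equals
    \<open>- c / a > 0\<close>.\<close>
  have "0 < (1 - a) * x - c"
    using affine_pos_between[of "1 - a" "- c / a" "- c" y x] y(3) lb \<open>x < y\<close> a_pos c_neg
    by (simp add: field_simps)
  moreover have "0 < x"
    using t(2) c_neg a_pos by (simp add: x_def)
  ultimately have "x \<in> D"
    using t(2) by (simp add: profile_range_def ax)
  moreover have "arclength a c d x < M"
  proof -
    have "- c * ln t < a\<^sup>2 * M - 1 + c + d"
      using t(1) c_neg by (simp add: r_def field_simps)
    then have "a * x - c * ln t - d < a\<^sup>2 * M"
      using ax t(3) by linarith
    then show ?thesis
      using a_pos by (simp add: arclength_def ax pos_divide_less_eq mult.commute)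
  qed
  ultimately show ?thesis
    using \<open>x < y\<close> by blast
qed

lemma not_bdd_below_J:
  assumes "J \<noteq> {}"
  shows "\<not> bdd_below J"
proof
  assume "bdd_below J"
  then obtain M where "\<And>s. s \<in> J \<Longrightarrow> M \<le> s"
    by (auto simp: bdd_below_def)
  moreover obtain y where "y \<in> D"
    using assms by (auto simp: J_def)
  ultimately show False
    using arclength_unbounded[of y M] by (force simp: J_def)
qed

lemma tendsto_h:
  assumes "J \<noteq> {}"
  shows "(h \<longlongrightarrow> - c / a) at_bot"
proof (rule order_tendstoI)
  obtain y where y: "y \<in> D"
    using assms by (auto simp: J_def)
  have below: "\<exists>x\<in>D. arclength a c d x \<le> s" for s
    using arclength_unbounded[OF y, of s] by force
  \<comment> \<open>\<open>J\<close> is an interval unbounded below, hence closed downwards.\<close>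
  have J_down: "s \<in> J" if "s \<le> arclength a c d x" "x \<in> D" for s x
  proof -
    obtain x' where "x' \<in> D" "arclength a c d x' \<le> s"
      using below by blast
    then show ?thesis
      using is_interval_J that unfolding is_interval_1 J_def by blast
  qed
  show "\<forall>\<^sub>F s in at_bot. e < h s" if "e < - c / a" for e
  proof (rule eventually_at_bot_linorderI)
    fix s assume "s \<le> arclength a c d y"
    then have "ereal (- c / a) < ereal (h s)"
      using J_down[OF _ y] h_in_D D_eq_einterval by blast
    then show "e < h s"
      using that by simp
  qed
  show "\<forall>\<^sub>F s in at_bot. h s < e" if e: "- c / a < e" for e
  proof -
    \<comment> \<open>Either \<open>y\<close> itself, or any point between \<open>- c / a\<close>
      and \<open>e\<close>; monotonicity then keeps \<open>h s\<close> at or below \<open>x\<close>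
      for all \<open>s\<close> up to \<open>arclength a c d x\<close>.\<close>
    obtain x where x: "x \<in> D" "x < e"
    proof (cases "y < e")
      case False
      obtain m where m: "- c / a < m" "m < e"
        using dense[OF e] by blast
      then have "ereal m < ereal y"
        using False by simp
      then have "ereal m < (if a \<le> 1 then \<infinity> else ereal (c / (1 - a)))"
        using y D_eq_einterval less_trans by blast
      then have "m \<in> D"
        using D_eq_einterval m(1) by simp
      then show ?thesis
        using that m(2) by blast
    qed (use y that in blast)
    show ?thesis
    proof (rule eventually_at_bot_linorderI)
      fix s assume s: "s \<le> arclength a c d x"
      then have "s \<in> J"
        using J_down x(1) by blast
      then have "\<not> x < h s"
        using s strict_mono_onD[OF arclength_strict_mono_on x(1) h_in_D] a_pos arclength_h
        by (metis less_irrefl not_le)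
      then show "h s < e"
        using x(2) by simp
    qed
  qed
qed

lemma asymptotic_to_admissible:
  assumes "admissible a c d I f"
  shows "asymptotic_to a c d I f (- c / a)"
proof -
  have ext: "extends_to I f J h"
    by (rule admissible_extends_to_h[OF assms])
  have "I \<noteq> {}"
    using assms by (auto simp: admissible_def rotational_ricci_def rotational_profile_def open_interval_def)
  then have "J \<noteq> {}"
    using ext by (auto simp: extends_to_def)
  moreover from this have "maximal_extension a c d I f J h"
    using ext admissible_h admissible_extends_to_h by (auto simp: maximal_extension_def)
  ultimately show ?thesis
    unfolding asymptotic_to_def
    by (intro exI[of _ J] exI[of _ h] conjI not_bdd_below_J tendsto_h)
qed

end

subsection \<open>The classification\<close>

theorem theorem3p5:
  fixes f g :: "real \<Rightarrow> real" and I :: "real set" and a c d s\<^sub>0 :: real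
    and K :: "real \<Rightarrow> real \<Rightarrow> real"
  assumes "rotational_ricci I f g"
    and "a \<noteq> 0" and "c \<noteq> 0"
    and "implicitly_defined a c d I f"
    and "K = gaussian_curvature (rot_param f g)"
    and "\<forall>s\<in>I. \<forall>\<theta>. K s \<theta> \<noteq> 0"
    and "(1 - a) * c > 0 \<Longrightarrow>
           s\<^sub>0 = c / (a * (1 - a)) - c / a\<^sup>2 * ln (c / (1 - a)) - d / a\<^sup>2"
  shows "strict_mono_on I f \<and> diffeomorphism_on I (f ` I) f \<and>
    ((\<forall>s\<in>I. \<forall>\<theta>. K s \<theta> < 0) \<and>
       a \<in> {0<..} \<and> c \<in> {..<0} \<and> asymptotic_to a c d I f (- c / a) \<and>
       (0 < a \<and> a \<le> 1 \<and> I \<subseteq> UNIV \<and> f ` I \<subseteq> {- c / a <..} \<or>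
        a > 1 \<and> I \<subseteq> {..<s\<^sub>0} \<and> f ` I \<subseteq> {- c / a <..< c / (1 - a)})
     \<or>
     (\<forall>s\<in>I. \<forall>\<theta>. K s \<theta> > 0) \<and>
       a \<in> {..<0} \<union> {0<..<1} \<and> c \<in> {0<..} \<and>
       (a < 0 \<and> I \<subseteq> {s\<^sub>0<..} \<and> f ` I \<subseteq> {c / (1 - a) <..< - c / a} \<or>
        0 < a \<and> a < 1 \<and> I \<subseteq> {s\<^sub>0<..} \<and> f ` I \<subseteq> {c / (1 - a) <..}))"
proof -
  interpret implicit_profile I f g a c d
    by (rule implicit_profileI) fact+
  \<comment> \<open>Split as \<open>c\<close> times a positive factor, so that \<open>K\<close> has
    the sign of \<open>c\<close>.\<close>
  have K: "K s \<theta> = c * ((a * f s + c) / f s ^ 4)" "0 < (a * f s + c) / f s ^ 4" if "s \<in> I" for s \<theta>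
    using f_pos[OF that] affine_f_pos[OF that] by (simp_all add: assms(5) gaussian_curvature_f[OF that])
  obtain s where s: "s \<in> I"
    using nonempty_I by blast
  \<comment> \<open>The value at which the slope \<open>a + c / x\<close> would be 1; there
    \<open>a x + c = x\<close>, which identifies \<open>s\<^sub>0\<close> as its
    \<open>arclength\<close>.\<close>
  define x\<^sub>0 where "x\<^sub>0 = c / (1 - a)"
  have x\<^sub>0: "0 < x\<^sub>0" "a * x\<^sub>0 + c = x\<^sub>0" "s\<^sub>0 = arclength a c d x\<^sub>0" if "(1 - a) * c > 0"
  proof -
    have "1 - a \<noteq> 0"
      using that by auto
    then show ax\<^sub>0: "a * x\<^sub>0 + c = x\<^sub>0"
      by (simp add: x\<^sub>0_def field_simps)
    show "0 < x\<^sub>0"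
      using that by (auto simp: x\<^sub>0_def zero_less_mult_iff zero_less_divide_iff)
    show "s\<^sub>0 = arclength a c d x\<^sub>0"
      unfolding assms(7)[OF that] arclength_def ax\<^sub>0 using a_nonzero \<open>1 - a \<noteq> 0\<close>
      by (simp add: x\<^sub>0_def field_simps power2_eq_square)
  qed
  have less_s\<^sub>0: "t < s\<^sub>0" if "(1 - a) * c > 0" "t \<in> I" "f t < x\<^sub>0" for t
    using arclength_strict_mono[OF a_nonzero f_pos[OF that(2)] that(3) affine_f_pos[OF that(2)], of d] x\<^sub>0[OF that(1)]
    by (simp add: arclength_f that(2))
  have greater_s\<^sub>0: "s\<^sub>0 < t" if "(1 - a) * c > 0" "t \<in> I" "x\<^sub>0 < f t" for t
    using arclength_strict_mono[OF a_nonzero _ that(3) _ affine_f_pos[OF that(2)], of d] x\<^sub>0[OF that(1)]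
    by (simp add: arclength_f that(2))
  show ?thesis
  proof (cases "c < 0")
    case True
    \<comment> \<open>A single point of \<open>I\<close> determines the sign of
      \<open>a\<close>.\<close>
    have "0 < a * f s"
      using affine_f_pos[OF s] True by linarith
    then have "0 < a"
      using f_pos[OF s] by (simp add: zero_less_mult_iff)
    interpret asymptotic_profile a c d
      using \<open>0 < a\<close> True by unfold_locales
    have "asymptotic_to a c d I f (- c / a)"
      using assms(1,4) by (intro asymptotic_to_admissible) (auto simp: admissible_def)
    moreover have "\<forall>s\<in>I. \<forall>\<theta>. K s \<theta> < 0"
      using K True by (metis mult_neg_pos)
    moreover have "- c / a < f t" if "t \<in> I" for t
      using affine_f_pos[OF that] \<open>0 < a\<close> by (simp add: field_simps)
    moreover have "f t < x\<^sub>0" "t < s\<^sub>0" if "t \<in> I" "1 < a" for t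
    proof -
      show "f t < x\<^sub>0"
        using f_in_profile_range[OF that(1)] that(2) by (simp add: x\<^sub>0_def profile_range_def field_simps)
      then show "t < s\<^sub>0"
        using less_s\<^sub>0 that True by (simp add: mult_neg_neg)
    qed
    ultimately show ?thesis
      using strict_mono_on_f diffeomorphism_on_f \<open>0 < a\<close> True by (cases "a \<le> 1") (auto simp: x\<^sub>0_def)
  next
    case False
    then have "0 < c"
      using c_nonzero by simp
    \<comment> \<open>Slope below 1 together with \<open>c > 0\<close> forces
      \<open>a < 1\<close>.\<close>
    have "0 < (1 - a) * f s"
      using f_in_profile_range[OF s] \<open>0 < c\<close> by (simp add: profile_range_def)
    then have "a < 1"
      using f_pos[OF s] by (simp add: zero_less_mult_iff)
    have "\<forall>s\<in>I. \<forall>\<theta>. K s \<theta> > 0"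
      using K \<open>0 < c\<close> by (metis mult_pos_pos)
    moreover have "x\<^sub>0 < f t" "s\<^sub>0 < t" if "t \<in> I" for t
    proof -
      show "x\<^sub>0 < f t"
        using f_in_profile_range[OF that(1)] \<open>a < 1\<close> by (simp add: x\<^sub>0_def profile_range_def field_simps)
      then show "s\<^sub>0 < t"
        using greater_s\<^sub>0 that \<open>a < 1\<close> \<open>0 < c\<close> by simp
    qed
    moreover have "f t < - c / a" if "t \<in> I" "a < 0" for t
      using affine_f_pos[OF that(1)] that(2) by (simp add: field_simps)
    ultimately show ?thesis
      using strict_mono_on_f diffeomorphism_on_f \<open>0 < c\<close> \<open>a < 1\<close> a_nonzero
      by (cases "a < 0") (auto simp: x\<^sub>0_def)
  qed
qed

end
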